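(* Fix $\delta_0=1/4$. For every integer $k\ge1$ and every $L>0$ there exist constants $c_k>0$ (depending only on $k$) and $\Omega_0>0$ such that, for every $0<\Omega\le\Omega_0$, any adaptive algorithm which, over the class of $L$-Lipschitz maps $\Phi:[0,1]^k\to[0,1]^k$, distinguishes between $$H_0:\ \Omega_\Phi(\delta_0)\ge2\Omega\qquad\text{and}\qquad H_1:\ \Omega_\Phi(\delta_0)=0$$ with error probability at most $1/3$ (under every $\Phi$ in $H_0$ and every $\Phi$ in $H_1$) requires $$B\ge c_kL^k\Omega^{-(k+2)}$$ Bernoulli coordinate observations.
   Context: For $\Phi:[0,1]^k\to[0,1]^k$ and $\delta>0$, $\Omega_\Phi(\delta)=\inf\{\lVert\Phi(s)-\Phi(s')\rVert_\infty:\ s,s'\in[0,1]^k,\ \lVert s-s'\rVert_\infty\ge\delta\}$. Lipschitz is with respect to the $\ell_\infty$ norms on domain and codomain. Observation model: $\Phi$ is unknown. At each of $B$ rounds the algorithm chooses a state $s\in[0,1]^k$ and a coordinate $\ell\in\{1,\dots,k\}$, possibly depending on all previous queries and observations and on internal randomization, and receives a fresh (conditionally independent of the past given the query) observation distributed as $\operatorname{Bernoulli}(\Phi_\ell(s))$. After $B$ observations it outputs $H_0$ or $H_1$. *)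

theory Defs
  imports "HOL-Probability.Probability"
begin

text \<open>Maps on the cube \<open>[0,1]\<^sup>k\<close> are functions on \<^typ>\<open>real ^ 'k\<close> with \<open>k = CARD('k)\<close>; their values
  outside \<open>cbox 0 1\<close> are irrelevant. \<^const>\<open>infnorm\<close> is the \<open>\<ell>\<^sub>\<infinity>\<close> norm.\<close>

definition separation_modulus :: "(real ^ 'k \<Rightarrow> real ^ 'k) \<Rightarrow> real \<Rightarrow> real" where
  "separation_modulus \<Phi> \<delta> =
     Inf {infnorm (\<Phi> s - \<Phi> s') | s s'. s \<in> cbox 0 1 \<and> s' \<in> cbox 0 1 \<and> infnorm (s - s') \<ge> \<delta>}"

definition lipschitz_self_maps :: "real \<Rightarrow> (real ^ 'k \<Rightarrow> real ^ 'k) set" where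
  "lipschitz_self_maps L =
     {\<Phi>. \<Phi> ` cbox 0 1 \<subseteq> cbox 0 1 \<and>
         (\<forall>s \<in> cbox 0 1. \<forall>s' \<in> cbox 0 1. infnorm (\<Phi> s - \<Phi> s') \<le> L * infnorm (s - s'))}"

datatype hypothesis = H0 | H1

type_synonym 'k query = "(real ^ 'k) \<times> 'k"

text \<open>Before round \<open>t\<close> the history records the queries and observations of rounds \<open>0, \<dots>, t - 1\<close>; it is
  undefined at all later rounds, as required by \<^const>\<open>PiM\<close>.\<close>

type_synonym 'k history = "nat \<Rightarrow> 'k query \<times> bool"

definition query_space :: "'k::finite query measure" where
  "query_space = restrict_space borel (cbox 0 1) \<Otimes>\<^sub>M count_space UNIV"

definition history_space :: "nat \<Rightarrow> 'k::finite history measure" where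
  "history_space t = PiM {..<t} (\<lambda>_. query_space \<Otimes>\<^sub>M count_space UNIV)"

text \<open>Internal randomization is a seed drawn once from an arbitrary probability space \<open>M\<close>.
  Seeds are real sequences, so that fresh randomness may be used in every round. Membership of
  the queried states in the cube is part of measurability into \<^const>\<open>query_space\<close>.\<close>

type_synonym seed = "nat \<Rightarrow> real"

definition adaptive_algorithm ::
  "nat \<Rightarrow> seed measure \<Rightarrow> (nat \<Rightarrow> seed \<times> 'k::finite history \<Rightarrow> 'k query)
     \<Rightarrow> (seed \<times> 'k history \<Rightarrow> hypothesis) \<Rightarrow> bool" where
  "adaptive_algorithm B M query decide \<longleftrightarrow>
     prob_space M \<and>
     (\<forall>t<B. query t \<in> M \<Otimes>\<^sub>M history_space t \<rightarrow>\<^sub>M query_space) \<and>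
     decide \<in> M \<Otimes>\<^sub>M history_space B \<rightarrow>\<^sub>M count_space UNIV"

primrec transcript ::
  "(real ^ 'k \<Rightarrow> real ^ 'k) \<Rightarrow> (nat \<Rightarrow> 'k history \<Rightarrow> 'k query) \<Rightarrow> nat \<Rightarrow> 'k history pmf" where
  "transcript \<Phi> q 0 = return_pmf (\<lambda>_. undefined)"
| "transcript \<Phi> q (Suc t) =
     bind_pmf (transcript \<Phi> q t) (\<lambda>h. case q t h of (s, l) \<Rightarrow>
       map_pmf (\<lambda>b. h(t := ((s, l), b))) (bernoulli_pmf (\<Phi> s $ l)))"

definition output_prob ::
  "(real ^ 'k \<Rightarrow> real ^ 'k) \<Rightarrow> nat \<Rightarrow> seed measure \<Rightarrow> (nat \<Rightarrow> seed \<times> 'k history \<Rightarrow> 'k query)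
     \<Rightarrow> (seed \<times> 'k history \<Rightarrow> hypothesis) \<Rightarrow> hypothesis \<Rightarrow> real" where
  "output_prob \<Phi> B M query decide v =
     (\<integral>\<omega>. measure_pmf.prob (transcript \<Phi> (\<lambda>t h. query t (\<omega>, h)) B) {h. decide (\<omega>, h) = v} \<partial>M)"

definition distinguishes ::
  "real \<Rightarrow> real \<Rightarrow> real \<Rightarrow> real \<Rightarrow> nat \<Rightarrow> seed measure
     \<Rightarrow> (nat \<Rightarrow> seed \<times> 'k::finite history \<Rightarrow> 'k query) \<Rightarrow> (seed \<times> 'k history \<Rightarrow> hypothesis) \<Rightarrow> bool" where
  "distinguishes L \<delta> \<Omega> \<epsilon> B M query decide \<longleftrightarrow>
     (\<forall>\<Phi> \<in> lipschitz_self_maps L.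
        (separation_modulus \<Phi> \<delta> \<ge> 2 * \<Omega> \<longrightarrow> output_prob \<Phi> B M query decide H1 \<le> \<epsilon>) \<and>
        (separation_modulus \<Phi> \<delta> = 0 \<longrightarrow> output_prob \<Phi> B M query decide H0 \<le> \<epsilon>))"

end

theory Submission
  imports Defs
begin

text \<open>The affine map \<open>s \<mapsto> 1/2 + 8\<Omega>s\<close> has separation modulus \<open>2\<Omega>\<close> at distance \<open>1/4\<close>. Lowering one of
  its coordinates by a bump of height \<open>2\<Omega>\<close>, slope \<open>L/2\<close> and hence radius \<open>4\<Omega>/L\<close> makes the bump's centre
  collide with a point at distance \<open>1/4\<close>. Of order \<open>(L/\<Omega>)\<^sup>k\<close> such bumps fit disjointly into the cube. A
  response inside a bump carries information of order \<open>\<Omega>\<^sup>2\<close> about it, and none about the others, while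
  each bump must receive a constant amount of information.\<close>

section \<open>Transcript laws for a fixed seed\<close>

text \<open>With the seed fixed, a round branches only on one response bit. Hence every real
  function is integrable under a transcript law.\<close>

lemma finite_set_transcript: "finite (set_pmf (transcript \<Phi> q t))"
  by (induction t) (auto split: prod.splits)

text \<open>The last round is integrated out. The bounds spare \<open>bernoulli_pmf\<close> any
  clamping of its parameter; they range over all \<open>s\<close> because \<open>q\<close> is
  arbitrary here and may leave the cube.\<close>

lemma expectation_transcript_Suc:
  fixes f :: "'k::finite history \<Rightarrow> real"
  assumes "\<And>s l. 0 \<le> \<Phi> s $ l" "\<And>s l. \<Phi> s $ l \<le> 1"
  shows "measure_pmf.expectation (transcript \<Phi> q (Suc t)) f =
    measure_pmf.expectation (transcript \<Phi> q t) (\<lambda>h.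
      let p = \<Phi> (fst (q t h)) $ snd (q t h)
      in p * f (h(t := (q t h, True))) + (1 - p) * f (h(t := (q t h, False))))"
proof -
  let ?A = "set_pmf (transcript \<Phi> q t)"
  have fin: "finite ?A"
    by (rule finite_set_transcript)
  show ?thesis
    unfolding transcript.simps
    by (subst pmf_expectation_bind[where A = ?A], (use fin in \<open>auto split: prod.splits\<close>)[3])
      (subst integral_measure_pmf[of ?A],
        use fin assms in \<open>auto split: prod.splits simp: Let_def algebra_simps intro!: sum.cong\<close>)
qed

section \<open>Information bounds between two transcript laws\<close>

text \<open>This is the chi-square divergence of Bernoulli(\<open>p\<close>) from
  Bernoulli(\<open>q\<close>), written as the mean under \<open>p\<close> of the likelihood ratio
  minus 1.\<close>

lemma chi_square_identity:
  fixes p q :: real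
  assumes "0 < q" "q < 1"
  shows "p * (p / q - 1) + (1 - p) * ((1 - p) / (1 - q) - 1) = (p - q)\<^sup>2 / (q * (1 - q))"
proof -
  have "q \<noteq> 0" "1 - q \<noteq> 0" using assms by auto
  then show ?thesis
    by (simp add: divide_simps) (simp add: power2_eq_square algebra_simps)
qed

text \<open>One round of the Gibbs variational inequality, with relative entropy replaced by the
  larger chi-square divergence.\<close>

lemma bernoulli_ln_mean_le:
  fixes p q x y :: real
  assumes "0 < p" "p < 1" "0 < q" "q < 1" "0 < x" "0 < y"
  shows "p * ln x + (1 - p) * ln y \<le> ln (q * x + (1 - q) * y) + (p - q)\<^sup>2 / (q * (1 - q))"
proof -
  define D where "D = q * x + (1 - q) * y"
  have D: "D > 0"
    unfolding D_def using assms by (intro add_pos_pos mult_pos_pos) auto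
  \<comment> \<open>One outcome, of probability \<open>r\<close> under the first law and
    \<open>u\<close> under the second. Apart from \<open>ln D\<close>, the logarithm splits into the
    ratio of the second law tilted by \<open>z\<close> to the first, and the likelihood ratio
    \<open>r / u\<close>.\<close>
  have split: "r * ln z \<le> r * ln D + (u * z / D - r) + r * (r / u - 1)"
    if "0 < r" "0 < u" "0 < z" for r u z :: real
  proof -
    have "ln z = ln D + ln (u * z / (r * D)) + ln (r / u)"
      using that D by (simp add: ln_mult ln_div)
    also have "\<dots> \<le> ln D + (u * z / (r * D) - 1) + (r / u - 1)"
      using that D by (intro add_mono order_refl ln_le_minus_one) auto
    finally have "r * ln z \<le> r * (ln D + (u * z / (r * D) - 1) + (r / u - 1))"
      using that by (intro mult_left_mono) auto
    also have "\<dots> = r * ln D + (u * z / D - r) + r * (r / u - 1)"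
      using that D by (simp add: algebra_simps)
    finally show ?thesis .
  qed
  have "p * ln x + (1 - p) * ln y \<le>
      (p * ln D + (q * x / D - p) + p * (p / q - 1)) +
      ((1 - p) * ln D + ((1 - q) * y / D - (1 - p)) + (1 - p) * ((1 - p) / (1 - q) - 1))"
    using assms by (intro add_mono split) auto
  \<comment> \<open>The tilted weights \<open>u * z / D\<close> sum to 1 over the two outcomes and
    so cancel against \<open>p\<close> and \<open>1 - p\<close>.\<close>
  also have "\<dots> = ln D + (D / D - 1) + (p * (p / q - 1) + (1 - p) * ((1 - p) / (1 - q) - 1))"
    by (subst (3) D_def) (simp add: algebra_simps add_divide_distrib diff_divide_distrib)
  also have "\<dots> = ln D + (p - q)\<^sup>2 / (q * (1 - q))"
    using D assms by (simp add: chi_square_identity)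
  finally show ?thesis unfolding D_def .
qed

text \<open>The Gibbs variational bound with \<open>d\<close> as a dual certificate: it is linear in both output
  laws, so that it can later be averaged over the seed without any convexity argument.\<close>

lemma transcript_gibbs_bound:
  fixes \<Phi> \<Psi> :: "real ^ 'k::finite \<Rightarrow> real ^ 'k"
  assumes \<Phi>: "\<And>s l. 0 < \<Phi> s $ l" "\<And>s l. \<Phi> s $ l < 1"
    and \<Psi>: "\<And>s l. 0 < \<Psi> s $ l" "\<And>s l. \<Psi> s $ l < 1"
    and d: "\<And>h. 0 < d h"
    and w: "\<And>s l. (\<Phi> s $ l - \<Psi> s $ l)\<^sup>2 / (\<Psi> s $ l * (1 - \<Psi> s $ l)) \<le> w (s, l)"
  shows "measure_pmf.expectation (transcript \<Phi> q B) (\<lambda>h. ln (d h)) \<le>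
    measure_pmf.expectation (transcript \<Psi> q B) d - 1 +
    (\<Sum>t<B. measure_pmf.expectation (transcript \<Phi> q t) (\<lambda>h. w (q t h)))"
  using d
proof (induction B arbitrary: d)
  case 0
  \<comment> \<open>The passage from the logarithm of the \<open>\<Psi>\<close>-mean to the mean
    itself happens only here, where the certificate is a single number; hence \<open>- 1\<close>
    occurs once.\<close>
  then show ?case by (simp add: ln_le_minus_one)
next
  case (Suc B)
  let ?p = "\<lambda>h. \<Phi> (fst (q B h)) $ snd (q B h)"
  let ?r = "\<lambda>h. \<Psi> (fst (q B h)) $ snd (q B h)"
  let ?x = "\<lambda>h. d (h(B := (q B h, True)))"
  let ?y = "\<lambda>h. d (h(B := (q B h, False)))"
  \<comment> \<open>The conditional mean of \<open>d\<close> under \<open>\<Psi>\<close> given the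
    first \<open>B\<close> rounds: the certificate handed to the induction hypothesis.\<close>
  let ?e = "\<lambda>h. ?r h * ?x h + (1 - ?r h) * ?y h"
  note int = integrable_measure_pmf_finite[OF finite_set_transcript]
  have "?p h * ln (?x h) + (1 - ?p h) * ln (?y h) \<le> ln (?e h) + w (q B h)" for h
    using bernoulli_ln_mean_le[of "?p h" "?r h" "?x h" "?y h"] \<Phi> \<Psi> Suc.prems
      w[of "fst (q B h)" "snd (q B h)"]
    by (smt (verit) prod.collapse)
  then have "measure_pmf.expectation (transcript \<Phi> q B)
      (\<lambda>h. ?p h * ln (?x h) + (1 - ?p h) * ln (?y h)) \<le>
    measure_pmf.expectation (transcript \<Phi> q B) (\<lambda>h. ln (?e h) + w (q B h))"
    by (intro integral_mono int) auto
  also have "\<dots> = measure_pmf.expectation (transcript \<Phi> q B) (\<lambda>h. ln (?e h)) +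
      measure_pmf.expectation (transcript \<Phi> q B) (\<lambda>h. w (q B h))"
    by (intro Bochner_Integration.integral_add int)
  also have "measure_pmf.expectation (transcript \<Phi> q B) (\<lambda>h. ln (?e h)) \<le>
      measure_pmf.expectation (transcript \<Psi> q B) ?e - 1 +
      (\<Sum>t<B. measure_pmf.expectation (transcript \<Phi> q t) (\<lambda>h. w (q t h)))"
    using \<Psi> Suc.prems by (intro Suc.IH add_pos_pos mult_pos_pos) auto
  finally show ?case
    using \<Phi> \<Psi>
    by (subst (1 2) expectation_transcript_Suc) (auto simp: Let_def less_imp_le)
qed

text \<open>If both error probabilities are at most 1/3, the left side is at least
  \<open>ln 2 / 3\<close> and the first two terms on the right sum to at most 0, so the accumulated
  information is at least \<open>ln 2 / 3\<close>.\<close>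

lemma transcript_test_bound:
  fixes \<Phi> \<Psi> :: "real ^ 'k::finite \<Rightarrow> real ^ 'k"
  assumes \<Phi>: "\<And>s l. 0 < \<Phi> s $ l" "\<And>s l. \<Phi> s $ l < 1"
    and \<Psi>: "\<And>s l. 0 < \<Psi> s $ l" "\<And>s l. \<Psi> s $ l < 1"
    and w: "\<And>s l. (\<Phi> s $ l - \<Psi> s $ l)\<^sup>2 / (\<Psi> s $ l * (1 - \<Psi> s $ l)) \<le> w (s, l)"
  shows "ln 2 * (1 - 2 * measure_pmf.prob (transcript \<Phi> q B) {h. D h = H1}) \<le>
    3 / 2 * measure_pmf.prob (transcript \<Psi> q B) {h. D h = H0} - 1 / 2 +
    (\<Sum>t<B. measure_pmf.expectation (transcript \<Phi> q t) (\<lambda>h. w (q t h)))"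
proof -
  \<comment> \<open>The optimal \<open>d\<close> is the ratio of the output laws under \<open>\<Phi>\<close> and \<open>\<Psi>\<close>; \<open>1/2\<close> and \<open>2\<close> are its values when both
    error probabilities equal \<open>1/3\<close>.\<close>
  define d :: "'k history \<Rightarrow> real" where "d h = (if D h = H1 then 1 / 2 else 2)" for h
  note int = integrable_measure_pmf_finite[OF finite_set_transcript]
  have "(\<lambda>h. ln (d h)) = (\<lambda>h. ln 2 - 2 * ln 2 * indicator {h. D h = H1} h)"
    by (auto simp: d_def ln_div)
  then have "measure_pmf.expectation (transcript \<Phi> q B) (\<lambda>h. ln (d h)) =
      ln 2 - 2 * ln 2 * measure_pmf.prob (transcript \<Phi> q B) {h. D h = H1}"
    by (simp add: int)
  moreover have "d = (\<lambda>h. 1 / 2 + 3 / 2 * indicator {h. D h = H0} h)"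
    by (auto simp: d_def fun_eq_iff intro: hypothesis.exhaust split: split_indicator)
  then have "measure_pmf.expectation (transcript \<Psi> q B) d =
      1 / 2 + 3 / 2 * measure_pmf.prob (transcript \<Psi> q B) {h. D h = H0}"
    by (simp add: int)
  moreover have "0 < d h" for h
    by (simp add: d_def)
  ultimately show ?thesis
    using transcript_gibbs_bound[of \<Phi> \<Psi> d w q B, OF \<Phi> \<Psi> _ w] by (simp add: algebra_simps)
qed

section \<open>Measurability in the seed\<close>

lemma borel_measurable_query_response:
  assumes "\<And>l. (\<lambda>s. \<Phi> s $ l) \<in> borel_measurable (restrict_space borel (cbox 0 1))"
  shows "(\<lambda>x. \<Phi> (fst x) $ snd x) \<in> borel_measurable (query_space :: 'k::finite query measure)"
  unfolding query_space_def
proof (rule measurable_compose_countable'[where I = UNIV and g = snd and f = "\<lambda>l x. \<Phi> (fst x) $ l"])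
  show "(\<lambda>x. \<Phi> (fst x) $ l) \<in> borel_measurable (restrict_space borel (cbox 0 1) \<Otimes>\<^sub>M count_space UNIV)"
    for l :: 'k
    by (rule measurable_compose[OF measurable_fst assms])
qed auto

text \<open>Averaging a bound over the seed needs measurable integrands. Integrating out the last
  round leaves a jointly measurable function of seed and shorter history, which drives the
  induction.\<close>

lemma borel_measurable_expectation_transcript:
  fixes \<Phi> :: "real ^ 'k::finite \<Rightarrow> real ^ 'k"
  assumes \<Phi>: "\<And>s l. 0 \<le> \<Phi> s $ l" "\<And>s l. \<Phi> s $ l \<le> 1"
    and meas: "\<And>l. (\<lambda>s. \<Phi> s $ l) \<in> borel_measurable (restrict_space borel (cbox 0 1))"
    and query: "\<And>t. t < B \<Longrightarrow> query t \<in> M \<Otimes>\<^sub>M history_space t \<rightarrow>\<^sub>M query_space"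
    and f: "f \<in> borel_measurable (M \<Otimes>\<^sub>M history_space B)"
  shows "(\<lambda>\<omega>. measure_pmf.expectation (transcript \<Phi> (\<lambda>t h. query t (\<omega>, h)) B)
    (\<lambda>h. f (\<omega>, h) :: real)) \<in> borel_measurable M"
  using query f
proof (induction B arbitrary: f)
  case 0
  \<comment> \<open>The product over no rounds has the everywhere undefined history as its only
    point.\<close>
  have "(\<lambda>\<omega>. (\<omega>, \<lambda>_. undefined)) \<in> M \<rightarrow>\<^sub>M M \<Otimes>\<^sub>M history_space 0"
    by (rule measurable_Pair) (auto simp: history_space_def space_PiM)
  from measurable_compose[OF this 0(2)] show ?case by simp
next
  case (Suc B)
  have q [measurable]: "query B \<in> M \<Otimes>\<^sub>M history_space B \<rightarrow>\<^sub>M query_space"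
    by (rule Suc.prems) simp
  have p [measurable]: "(\<lambda>x. \<Phi> (fst (query B x)) $ snd (query B x)) \<in>
      borel_measurable (M \<Otimes>\<^sub>M history_space B)"
    by (rule measurable_compose[OF q borel_measurable_query_response[OF meas]])
  have "(\<lambda>x. (fst x, (snd x)(B := (query B x, b)))) \<in>
      M \<Otimes>\<^sub>M history_space B \<rightarrow>\<^sub>M M \<Otimes>\<^sub>M history_space (Suc B)" for b
  proof (rule measurable_Pair)
    have "(\<lambda>x. (snd x, (query B x, b))) \<in> M \<Otimes>\<^sub>M history_space B \<rightarrow>\<^sub>M
        history_space B \<Otimes>\<^sub>M (query_space \<Otimes>\<^sub>M count_space UNIV)"
      by measurable
    from measurable_compose[OF this[unfolded history_space_def] measurable_add_dim]
    show "(\<lambda>x. (snd x)(B := (query B x, b))) \<in>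
        M \<Otimes>\<^sub>M history_space B \<rightarrow>\<^sub>M history_space (Suc B)"
      by (simp add: history_space_def lessThan_Suc)
  qed simp
  from measurable_compose[OF this Suc.prems(2)]
  have [measurable]: "(\<lambda>x. f (fst x, (snd x)(B := (query B x, b)))) \<in>
      borel_measurable (M \<Otimes>\<^sub>M history_space B)" for b .
  let ?g = "\<lambda>x. \<Phi> (fst (query B x)) $ snd (query B x) * f (fst x, (snd x)(B := (query B x, True))) +
    (1 - \<Phi> (fst (query B x)) $ snd (query B x)) * f (fst x, (snd x)(B := (query B x, False)))"
  have "?g \<in> borel_measurable (M \<Otimes>\<^sub>M history_space B)"
    by measurable
  from Suc.IH[OF _ this] Suc.prems(1) show ?case
    unfolding expectation_transcript_Suc[OF \<Phi>] Let_def by simp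
qed

lemma integrable_decision_prob:
  fixes \<Phi> :: "real ^ 'k::finite \<Rightarrow> real ^ 'k"
  assumes "\<And>s l. 0 \<le> \<Phi> s $ l" "\<And>s l. \<Phi> s $ l \<le> 1"
    and "\<And>l. (\<lambda>s. \<Phi> s $ l) \<in> borel_measurable (restrict_space borel (cbox 0 1))"
    and alg: "adaptive_algorithm B M query decide"
  shows "integrable M (\<lambda>\<omega>. measure_pmf.prob (transcript \<Phi> (\<lambda>t h. query t (\<omega>, h)) B)
    {h. decide (\<omega>, h) = v})"
proof -
  have M: "prob_space M"
    and query: "\<And>t. t < B \<Longrightarrow> query t \<in> M \<Otimes>\<^sub>M history_space t \<rightarrow>\<^sub>M query_space"
    and [measurable]: "decide \<in> M \<Otimes>\<^sub>M history_space B \<rightarrow>\<^sub>M count_space UNIV"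
    using alg by (auto simp: adaptive_algorithm_def)
  interpret prob_space M by (rule M)
  have "(\<lambda>x. if decide x = v then 1 else 0 :: real) \<in> borel_measurable (M \<Otimes>\<^sub>M history_space B)"
    by measurable
  from borel_measurable_expectation_transcript[OF assms(1-3) query this]
  have "(\<lambda>\<omega>. measure_pmf.expectation (transcript \<Phi> (\<lambda>t h. query t (\<omega>, h)) B)
      (\<lambda>h. if decide (\<omega>, h) = v then 1 else 0 :: real)) \<in> borel_measurable M" .
  moreover have "(\<lambda>h. if decide (\<omega>, h) = v then 1 else 0 :: real) = indicator {h. decide (\<omega>, h) = v}" for \<omega>
    by auto
  ultimately have "(\<lambda>\<omega>. measure_pmf.prob (transcript \<Phi> (\<lambda>t h. query t (\<omega>, h)) B)
      {h. decide (\<omega>, h) = v}) \<in> borel_measurable M"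
    by simp
  then show ?thesis
    by (intro integrable_const_bound[where B = 1]) auto
qed

section \<open>The base map and the bumped maps\<close>

lemma infnorm_cart_le:
  fixes x :: "real ^ 'k"
  assumes "\<And>i. \<bar>x $ i\<bar> \<le> a"
  shows "infnorm x \<le> a"
  unfolding infnorm_cart using assms by (intro cSup_least) auto

lemma infnorm_const: "infnorm ((\<chi> i. a) :: real ^ 'k) = \<bar>a\<bar>"
  using component_le_infnorm_cart[of "(\<chi> i. a) :: real ^ 'k" undefined]
  by (intro antisym infnorm_cart_le) auto

text \<open>Off the cube the map takes a fixed interior value, so that response probabilities stay away
  from 0 and 1 at every point of the type.\<close>

definition base_map :: "real \<Rightarrow> real ^ 'k \<Rightarrow> real ^ 'k" where
  "base_map \<Omega> s = (\<chi> i. if s \<in> cbox 0 1 then 1 / 2 + 8 * \<Omega> * s $ i else 1 / 2)"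

text \<open>Slope \<open>L / 2\<close> leaves half of the Lipschitz budget to the base map.\<close>

definition bump :: "real \<Rightarrow> real \<Rightarrow> real ^ 'k \<Rightarrow> real ^ 'k \<Rightarrow> real" where
  "bump L \<Omega> c s = max 0 (2 * \<Omega> - L / 2 * infnorm (s - c))"

definition bumped_map :: "'k \<Rightarrow> real \<Rightarrow> real \<Rightarrow> real ^ 'k \<Rightarrow> real ^ 'k \<Rightarrow> real ^ 'k" where
  "bumped_map l L \<Omega> c s = (\<chi> i. base_map \<Omega> s $ i - (if i = l then bump L \<Omega> c s else 0))"

lemma bump_bounds:
  assumes "0 \<le> \<Omega>" "0 \<le> L"
  shows "0 \<le> bump L \<Omega> c s" "bump L \<Omega> c s \<le> 2 * \<Omega>"
  using assms by (auto simp: bump_def infnorm_pos_le)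

text \<open>Reverse triangle inequality; truncation at 0 does not increase differences.\<close>

lemma bump_lipschitz:
  assumes "0 \<le> L"
  shows "\<bar>bump L \<Omega> c s - bump L \<Omega> c s'\<bar> \<le> L / 2 * infnorm (s - s')"
proof -
  have "\<bar>infnorm (s - c) - infnorm (s' - c)\<bar> \<le> infnorm (s - s')"
    using absdiff_infnorm[of "s - c" "s' - c"] by simp
  then have "L / 2 * \<bar>infnorm (s - c) - infnorm (s' - c)\<bar> \<le> L / 2 * infnorm (s - s')"
    using assms by (intro mult_left_mono) auto
  moreover have "L / 2 * \<bar>infnorm (s - c) - infnorm (s' - c)\<bar> =
      \<bar>L / 2 * infnorm (s - c) - L / 2 * infnorm (s' - c)\<bar>"
    using assms by (subst right_diff_distrib[symmetric]) (simp add: abs_mult)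
  ultimately show ?thesis
    unfolding bump_def by linarith
qed

lemma base_map_bounds:
  assumes "0 \<le> \<Omega>" "\<Omega> \<le> 1 / 32"
  shows "1 / 2 \<le> base_map \<Omega> s $ i" "base_map \<Omega> s $ i \<le> 3 / 4"
proof -
  have "0 \<le> \<Omega> * s $ i \<and> \<Omega> * s $ i \<le> 1 / 32 * 1" if "s \<in> cbox 0 1"
    using that assms by (intro conjI mult_mono mult_nonneg_nonneg) (auto simp: mem_box_cart)
  then show "1 / 2 \<le> base_map \<Omega> s $ i" "base_map \<Omega> s $ i \<le> 3 / 4"
    by (auto simp: base_map_def)
qed

text \<open>The bump removes at most \<open>2 * \<Omega> \<le> 1 / 16\<close> from a value in
  [1/2, 3/4]. Staying away from 0 and 1 bounds the Bernoulli variance from below.\<close>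

lemma bumped_map_bounds:
  assumes "0 \<le> \<Omega>" "\<Omega> \<le> 1 / 32" "0 \<le> L"
  shows "1 / 4 \<le> bumped_map l L \<Omega> c s $ i" "bumped_map l L \<Omega> c s $ i \<le> 3 / 4"
  using base_map_bounds[of \<Omega> s i] bump_bounds[of \<Omega> L c s] assms by (auto simp: bumped_map_def)

lemma base_map_diff:
  assumes "s \<in> cbox 0 1" "s' \<in> cbox 0 1"
  shows "base_map \<Omega> s - base_map \<Omega> s' = (8 * \<Omega>) *\<^sub>R (s - s')"
  using assms by (simp add: base_map_def vec_eq_iff algebra_simps)

lemma base_map_lipschitz:
  fixes s s' :: "real ^ 'k"
  assumes "0 \<le> \<Omega>" "16 * \<Omega> \<le> L" "s \<in> cbox 0 1" "s' \<in> cbox 0 1"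
  shows "infnorm (base_map \<Omega> s - base_map \<Omega> s') \<le> L / 2 * infnorm (s - s')"
  unfolding base_map_diff[OF assms(3,4)] infnorm_mul
  using assms by (intro mult_right_mono) (auto simp: infnorm_pos_le)

lemma base_map_in_lipschitz_self_maps:
  assumes "0 \<le> \<Omega>" "\<Omega> \<le> 1 / 32" "16 * \<Omega> \<le> L"
  shows "(base_map \<Omega> :: real ^ 'k \<Rightarrow> real ^ 'k) \<in> lipschitz_self_maps L"
proof -
  have "0 \<le> base_map \<Omega> s $ i \<and> base_map \<Omega> s $ i \<le> 1" for s :: "real ^ 'k" and i
    using base_map_bounds[OF assms(1,2), of s i] by linarith
  then have "base_map \<Omega> s \<in> cbox 0 1" for s :: "real ^ 'k"
    by (simp add: mem_box_cart)
  moreover have "infnorm (base_map \<Omega> s - base_map \<Omega> s') \<le> L * infnorm (s - s')"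
    if "s \<in> cbox 0 1" "s' \<in> cbox 0 1" for s s' :: "real ^ 'k"
  proof -
    note base_map_lipschitz[OF assms(1,3) that]
    also have "L / 2 * infnorm (s - s') \<le> L * infnorm (s - s')"
      using assms by (intro mult_right_mono) (auto simp: infnorm_pos_le)
    finally show ?thesis .
  qed
  ultimately show ?thesis
    unfolding lipschitz_self_maps_def by auto
qed

lemma bumped_map_in_lipschitz_self_maps:
  assumes "0 \<le> \<Omega>" "\<Omega> \<le> 1 / 32" "16 * \<Omega> \<le> L"
  shows "bumped_map l L \<Omega> c \<in> lipschitz_self_maps L"
proof -
  have L: "0 \<le> L" using assms by auto
  have "0 \<le> bumped_map l L \<Omega> c s $ i \<and> bumped_map l L \<Omega> c s $ i \<le> 1" for s i
    using bumped_map_bounds[OF assms(1,2) L, of l c s i] by linarith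
  then have "bumped_map l L \<Omega> c s \<in> cbox 0 1" for s
    by (simp add: mem_box_cart)
  moreover have "infnorm (bumped_map l L \<Omega> c s - bumped_map l L \<Omega> c s') \<le> L * infnorm (s - s')"
    if "s \<in> cbox 0 1" "s' \<in> cbox 0 1" for s s'
  proof (rule infnorm_cart_le)
    fix i
    have "\<bar>(base_map \<Omega> s - base_map \<Omega> s') $ i\<bar> \<le> L / 2 * infnorm (s - s')"
      using component_le_infnorm_cart base_map_lipschitz[OF assms(1,3) that] by (rule order_trans)
    moreover have "0 \<le> L / 2 * infnorm (s - s')"
      using L by (simp add: infnorm_pos_le)
    moreover have "\<bar>(bumped_map l L \<Omega> c s - bumped_map l L \<Omega> c s') $ i\<bar> \<le>
        \<bar>(base_map \<Omega> s - base_map \<Omega> s') $ i\<bar> + \<bar>bump L \<Omega> c s - bump L \<Omega> c s'\<bar>"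
      unfolding bumped_map_def vector_minus_component vec_lambda_beta by (smt (verit))
    ultimately show "\<bar>(bumped_map l L \<Omega> c s - bumped_map l L \<Omega> c s') $ i\<bar> \<le> L * infnorm (s - s')"
      using bump_lipschitz[OF L, of \<Omega> c s s'] by linarith
  qed
  ultimately show ?thesis
    unfolding lipschitz_self_maps_def by auto
qed

text \<open>On the cube, distances are multiplied by exactly \<open>8 * \<Omega>\<close>.\<close>

lemma separation_modulus_base_map:
  assumes "0 \<le> \<Omega>"
  shows "2 * \<Omega> \<le> separation_modulus (base_map \<Omega> :: real ^ 'k \<Rightarrow> real ^ 'k) (1 / 4)"
  unfolding separation_modulus_def
proof (rule cInf_greatest)
  \<comment> \<open>Opposite corners of the cube show that the infimum is over a nonempty
    set.\<close>
  have "infnorm (1 - 0 :: real ^ 'k) \<ge> 1 / 4"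
    using infnorm_const[where 'k = 'k and a = 1] by (simp add: one_vec_def)
  moreover have "0 \<in> cbox (0 :: real ^ 'k) 1" "1 \<in> cbox (0 :: real ^ 'k) 1"
    by (auto simp: mem_box_cart)
  ultimately show "{infnorm (base_map \<Omega> s - base_map \<Omega> s') | s s' :: real ^ 'k.
      s \<in> cbox 0 1 \<and> s' \<in> cbox 0 1 \<and> infnorm (s - s') \<ge> 1 / 4} \<noteq> {}"
    by blast
next
  fix x
  assume "x \<in> {infnorm (base_map \<Omega> s - base_map \<Omega> s') | s s' :: real ^ 'k.
      s \<in> cbox 0 1 \<and> s' \<in> cbox 0 1 \<and> infnorm (s - s') \<ge> 1 / 4}"
  then obtain s s' :: "real ^ 'k" where "x = infnorm (base_map \<Omega> s - base_map \<Omega> s')"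
      "s \<in> cbox 0 1" "s' \<in> cbox 0 1" and far: "infnorm (s - s') \<ge> 1 / 4"
    by blast
  then have "x = 8 * \<Omega> * infnorm (s - s')"
    using assms by (simp add: base_map_diff infnorm_mul)
  then show "2 * \<Omega> \<le> x"
    using mult_left_mono[OF far, of "8 * \<Omega>"] assms by simp
qed

text \<open>The bump at \<open>c\<close> lowers coordinate \<open>l\<close> by \<open>2\<Omega>\<close>, exactly the increment of the base map between
  \<open>c - e\<^sub>l/4\<close> and \<open>c\<close>.\<close>

lemma separation_modulus_bumped_map:
  fixes c :: "real ^ 'k"
  assumes "0 \<le> \<Omega>" "16 * \<Omega> \<le> L" and c: "\<And>i. 1 / 4 \<le> c $ i" "\<And>i. c $ i \<le> 1"
  shows "separation_modulus (bumped_map l L \<Omega> c) (1 / 4) = 0"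
proof -
  define s where "s = c - axis l (1 / 4)"
  have [simp]: "s $ i = (if i = l then c $ i - 1 / 4 else c $ i)" for i
    by (simp add: s_def axis_def)
  have "0 \<le> c $ i - 1 / 4" "c $ i - 1 / 4 \<le> 1" "0 \<le> c $ i" for i
    using c[of i] by linarith+
  with c have cube: "c \<in> cbox 0 1" "s \<in> cbox 0 1"
    by (simp_all add: mem_box_cart)
  have dist: "infnorm (s - c) = 1 / 4"
  proof (rule antisym)
    show "infnorm (s - c) \<le> 1 / 4"
      by (rule infnorm_cart_le) auto
    show "1 / 4 \<le> infnorm (s - c)"
      using component_le_infnorm_cart[of "s - c" l] by simp
  qed
  \<comment> \<open>At distance 1/4 the bump has dropped by \<open>L / 8\<close>, which is at least
    its height \<open>2 * \<Omega>\<close>.\<close>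
  have "bump L \<Omega> c s = 0" "bump L \<Omega> c c = 2 * \<Omega>"
    using assms(1,2) by (simp_all add: bump_def infnorm_0 dist)
  then have collision: "bumped_map l L \<Omega> c s - bumped_map l L \<Omega> c c = 0"
    using cube by (auto simp: bumped_map_def base_map_def vec_eq_iff algebra_simps)
  have mem: "0 \<in> {infnorm (bumped_map l L \<Omega> c s - bumped_map l L \<Omega> c s') | s s'.
      s \<in> cbox 0 1 \<and> s' \<in> cbox 0 1 \<and> infnorm (s - s') \<ge> 1 / 4}"
    unfolding mem_Collect_eq
    by (rule exI[where x = s], rule exI[where x = c]) (use collision cube dist in \<open>simp add: infnorm_0\<close>)
  show ?thesis
    unfolding separation_modulus_def
    by (intro cInf_eq_minimum[OF mem]) (auto simp: infnorm_pos_le)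
qed

lemma borel_measurable_base_map:
  "(\<lambda>s :: real ^ 'k. base_map \<Omega> s $ i) \<in> borel_measurable (restrict_space borel (cbox 0 1))"
proof -
  have "continuous_on (cbox 0 1) (\<lambda>s :: real ^ 'k. 1 / 2 + 8 * \<Omega> * s $ i)"
    by (intro continuous_intros)
  then have "(\<lambda>s. 1 / 2 + 8 * \<Omega> * s $ i) \<in> borel_measurable (restrict_space borel (cbox 0 1 :: (real ^ 'k) set))"
    by (rule borel_measurable_continuous_on_restrict)
  then show ?thesis
    by (rule measurable_cong[THEN iffD1, rotated]) (auto simp: base_map_def space_restrict_space)
qed

lemma borel_measurable_bumped_map:
  "(\<lambda>s. bumped_map l L \<Omega> c s $ i) \<in> borel_measurable (restrict_space borel (cbox 0 1))"
proof -
  have "continuous_on (cbox 0 1) (bump L \<Omega> c)"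
    unfolding bump_def by (intro continuous_intros)
  then have "bump L \<Omega> c \<in> borel_measurable (restrict_space borel (cbox 0 1))"
    by (rule borel_measurable_continuous_on_restrict)
  then show ?thesis
    unfolding bumped_map_def using borel_measurable_base_map[of \<Omega> i]
    by (cases "i = l") auto
qed

text \<open>Inside the ball the difference is at most \<open>2 * \<Omega>\<close> and the variance
  at least 3/16; outside, the two maps agree.\<close>

lemma bumped_map_chi_square:
  assumes "0 \<le> \<Omega>" "\<Omega> \<le> 1 / 32" "0 < L"
  shows "(base_map \<Omega> s $ i - bumped_map l L \<Omega> c s $ i)\<^sup>2 /
      (bumped_map l L \<Omega> c s $ i * (1 - bumped_map l L \<Omega> c s $ i))
    \<le> 64 / 3 * \<Omega>\<^sup>2 * indicator {s. infnorm (s - c) < 4 * \<Omega> / L} s"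
proof -
  define q where "q = bumped_map l L \<Omega> c s $ i"
  define b where "b = base_map \<Omega> s $ i - q"
  have L: "0 \<le> L" using assms by simp
  have q: "1 / 4 \<le> q" "q \<le> 3 / 4"
    unfolding q_def using bumped_map_bounds[OF assms(1,2) L] by auto
  have "q * (1 - q) - 3 / 16 = (q - 1 / 4) * (3 / 4 - q)"
    by (simp add: field_simps)
  also have "\<dots> \<ge> 0"
    using q by (intro mult_nonneg_nonneg) auto
  finally have pq: "3 / 16 \<le> q * (1 - q)"
    by simp
  have b: "b = (if i = l then bump L \<Omega> c s else 0)"
    by (simp add: b_def q_def bumped_map_def)
  have "b\<^sup>2 / (q * (1 - q)) \<le> 64 / 3 * \<Omega>\<^sup>2 * indicator {s. infnorm (s - c) < 4 * \<Omega> / L} s"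
  proof (cases "infnorm (s - c) < 4 * \<Omega> / L")
    case True
    have "b\<^sup>2 \<le> (2 * \<Omega>)\<^sup>2"
      using bump_bounds[OF assms(1) L, of c s] assms by (intro power_mono) (auto simp: b)
    then have "b\<^sup>2 / (q * (1 - q)) \<le> (2 * \<Omega>)\<^sup>2 / (3 / 16)"
      using pq by (intro frac_le) auto
    then show ?thesis using True by (simp add: power2_eq_square)
  next
    case False
    then have "4 * \<Omega> \<le> L * infnorm (s - c)"
      using assms by (simp add: field_simps)
    then have "b = 0" by (simp add: b bump_def)
    then show ?thesis by simp
  qed
  then show ?thesis by (simp add: b_def q_def)
qed

section \<open>Packing the bumps\<close>

text \<open>The offset 1/4 leaves room in the cube for the partner point
  \<open>c - e\<^sub>l/4\<close> of a bump's centre; the spacing \<open>2 * r\<close> separates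
  balls of radius \<open>r\<close>.\<close>

definition grid_point :: "real \<Rightarrow> ('k \<Rightarrow> nat) \<Rightarrow> real ^ 'k" where
  "grid_point r m = (\<chi> i. 1 / 4 + 2 * r * real (m i))"

text \<open>In each coordinate the centres are less than \<open>2 * r\<close> apart, and grid
  coordinates differ by integer multiples of \<open>2 * r\<close>.\<close>

lemma grid_balls_disjoint:
  fixes m m' :: "'k::finite \<Rightarrow> nat"
  assumes "infnorm (s - grid_point r m) < r" "infnorm (s - grid_point r m') < r"
  shows "m = m'"
proof (rule ext)
  fix i
  have "\<bar>(s - grid_point r m) $ i\<bar> < r" "\<bar>(s - grid_point r m') $ i\<bar> < r"
    using assms component_le_infnorm_cart le_less_trans by blast+
  then have "\<bar>2 * r * real (m i) - 2 * r * real (m' i)\<bar> < 2 * r" "0 < r"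
    by (auto simp: grid_point_def)
  then have "2 * r * \<bar>real (m i) - real (m' i)\<bar> < 2 * r * 1"
    by (simp add: abs_mult flip: right_diff_distrib)
  then have "\<bar>real (m i) - real (m' i)\<bar> < 1"
    using \<open>0 < r\<close> by simp
  then show "m i = m' i" by linarith
qed

text \<open>A query informs about at most one bump. This turns the number of bumps into a factor in
  the bound on \<open>B\<close>.\<close>

lemma sum_grid_indicator_le_1:
  fixes s :: "real ^ 'k"
  assumes "finite J"
  shows "(\<Sum>m\<in>J. indicator {s. infnorm (s - grid_point r m) < r} s :: real) \<le> 1"
proof -
  have "(\<Sum>m\<in>J. indicator {s. infnorm (s - grid_point r m) < r} s :: real) =
      card {m \<in> J. infnorm (s - grid_point r m) < r}"
    using assms by (simp add: indicator_def sum.If_cases Int_def)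
  also have "\<dots> \<le> 1"
    using assms grid_balls_disjoint[of s r] by (auto simp: card_le_Suc0_iff_eq)
  finally show ?thesis .
qed

section \<open>Summing the information over all bumps\<close>

text \<open>Each of the \<open>n ^ CARD('k)\<close> bumps needs information \<open>ln 2 / 3\<close>,
  and one round supplies at most \<open>64 / 3 * \<Omega>\<^sup>2\<close> to all of them together.
  The condition on \<open>n\<close> fits \<open>n\<close> grid steps of length
  \<open>8 * \<Omega> / L\<close> into [1/4, 1].\<close>

lemma rounds_lower_bound:
  fixes query :: "nat \<Rightarrow> seed \<times> 'k::finite history \<Rightarrow> 'k query"
  assumes \<Omega>: "0 < \<Omega>" "\<Omega> \<le> 1 / 32" "16 * \<Omega> \<le> L"
    and alg: "adaptive_algorithm B M query decide"
    and dist: "distinguishes L (1 / 4) \<Omega> (1 / 3) B M query decide"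
    and n: "8 * \<Omega> / L * real n \<le> 3 / 4"
  shows "ln 2 / 3 * real n ^ CARD('k) \<le> 64 / 3 * \<Omega>\<^sup>2 * real B"
proof -
  define r where "r = 4 * \<Omega> / L"
  define J where "J = (UNIV :: 'k set) \<rightarrow>\<^sub>E {..<n}"
  \<comment> \<open>An arbitrary coordinate; all bumps lower the same one.\<close>
  define l :: 'k where "l = undefined"
  define \<Psi> where "\<Psi> m = bumped_map l L \<Omega> (grid_point r m)" for m
  define I :: "('k \<Rightarrow> nat) \<Rightarrow> 'k query \<Rightarrow> real"
    where "I m x = indicator {s. infnorm (s - grid_point r m) < r} (fst x)" for m x
  define T where "T \<omega> = transcript (base_map \<Omega>) (\<lambda>t h. query t (\<omega>, h))" for \<omega>
  define a where "a \<omega> = measure_pmf.prob (T \<omega> B) {h. decide (\<omega>, h) = H1}" for \<omega>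
  define b where "b m \<omega> = measure_pmf.prob (transcript (\<Psi> m) (\<lambda>t h. query t (\<omega>, h)) B)
    {h. decide (\<omega>, h) = H0}" for m \<omega>
  have L: "0 < L" and r: "0 < r" using \<Omega> by (auto simp: r_def)
  interpret prob_space M
    using alg by (simp add: adaptive_algorithm_def)
  have J: "finite J" "card J = n ^ CARD('k)"
    by (auto simp: J_def card_PiE intro: finite_PiE)
  have base: "0 < base_map \<Omega> s $ i" "base_map \<Omega> s $ i < 1" for s :: "real ^ 'k" and i
    using base_map_bounds[of \<Omega> s i] \<Omega> by auto
  have bumped: "0 < \<Psi> m s $ i" "\<Psi> m s $ i < 1" for m s i
    using bumped_map_bounds[of \<Omega> L l "grid_point r m" s i] \<Omega> L by (auto simp: \<Psi>_def)
  have int_a: "integrable M a"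
    unfolding a_def T_def
    by (intro integrable_decision_prob[OF _ _ _ alg] less_imp_le base borel_measurable_base_map)
  have "(\<lambda>s. \<Psi> m s $ i) \<in> borel_measurable (restrict_space borel (cbox 0 1))" for m i
    unfolding \<Psi>_def by (rule borel_measurable_bumped_map)
  then have int_b: "integrable M (b m)" for m
    unfolding b_def by (intro integrable_decision_prob[OF _ _ _ alg] less_imp_le bumped)
  have a: "(\<integral>\<omega>. a \<omega> \<partial>M) \<le> 1 / 3"
    using dist base_map_in_lipschitz_self_maps[of \<Omega> L, where 'k = 'k] separation_modulus_base_map[of \<Omega>, where 'k = 'k] \<Omega>
    by (auto simp: distinguishes_def output_prob_def a_def T_def)
  have b: "(\<integral>\<omega>. b m \<omega> \<partial>M) \<le> 1 / 3" if "m \<in> J" for m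
  proof -
    have "1 / 4 \<le> grid_point r m $ i" "grid_point r m $ i \<le> 1" for i
    proof -
      have "2 * r * real (m i) \<le> 2 * r * real n"
        using that r by (intro mult_left_mono) (auto simp: J_def PiE_iff less_imp_le)
      also have "\<dots> \<le> 3 / 4"
        using n by (simp add: r_def)
      finally have "2 * r * real (m i) \<le> 3 / 4" .
      moreover have "0 \<le> 2 * r * real (m i)"
        using r by simp
      ultimately show "1 / 4 \<le> grid_point r m $ i" "grid_point r m $ i \<le> 1"
        unfolding grid_point_def vec_lambda_beta by linarith+
    qed
    then have "separation_modulus (\<Psi> m) (1 / 4) = 0"
      unfolding \<Psi>_def using \<Omega> r by (intro separation_modulus_bumped_map) auto
    moreover have "\<Psi> m \<in> lipschitz_self_maps L"
      unfolding \<Psi>_def using \<Omega> by (intro bumped_map_in_lipschitz_self_maps) auto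
    ultimately show ?thesis
      using dist by (auto simp: distinguishes_def output_prob_def b_def)
  qed
  have pointwise: "card J * (ln 2 * (1 - 2 * a \<omega>)) \<le>
      (\<Sum>m\<in>J. 3 / 2 * b m \<omega> - 1 / 2) + 64 / 3 * \<Omega>\<^sup>2 * B" for \<omega>
  proof -
    note int = integrable_measure_pmf_finite[OF finite_set_transcript]
    let ?E = "\<lambda>m t. measure_pmf.expectation (T \<omega> t) (\<lambda>h. 64 / 3 * \<Omega>\<^sup>2 * I m (query t (\<omega>, h)))"
    have "ln 2 * (1 - 2 * a \<omega>) \<le> 3 / 2 * b m \<omega> - 1 / 2 + (\<Sum>t<B. ?E m t)" for m
      unfolding a_def b_def T_def
    proof (rule transcript_test_bound)
      show "(base_map \<Omega> s $ i - \<Psi> m s $ i)\<^sup>2 / (\<Psi> m s $ i * (1 - \<Psi> m s $ i)) \<le> 64 / 3 * \<Omega>\<^sup>2 * I m (s, i)" for s i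
        using bumped_map_chi_square[of \<Omega> L s i l "grid_point r m"] \<Omega> L by (simp add: \<Psi>_def I_def r_def)
    qed (use base bumped in auto)
    then have "(\<Sum>m\<in>J. ln 2 * (1 - 2 * a \<omega>)) \<le> (\<Sum>m\<in>J. 3 / 2 * b m \<omega> - 1 / 2 + (\<Sum>t<B. ?E m t))"
      by (rule sum_mono)
    also have "\<dots> = (\<Sum>m\<in>J. 3 / 2 * b m \<omega> - 1 / 2) + (\<Sum>t<B. \<Sum>m\<in>J. ?E m t)"
      by (simp only: sum.distrib sum.swap[of _ _ J])
    also have "(\<Sum>t<B. \<Sum>m\<in>J. ?E m t) \<le> (\<Sum>t<B. 64 / 3 * \<Omega>\<^sup>2)"
    proof (rule sum_mono)
      fix t
      \<comment> \<open>All these expectations are under the base map's law, which does not depend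
        on \<open>m\<close>, so the sum moves inside.\<close>
      have "(\<Sum>m\<in>J. ?E m t) =
          measure_pmf.expectation (T \<omega> t) (\<lambda>h. 64 / 3 * \<Omega>\<^sup>2 * (\<Sum>m\<in>J. I m (query t (\<omega>, h))))"
        unfolding T_def sum_distrib_left by (rule Bochner_Integration.integral_sum[symmetric]) (rule int)
      also have "\<dots> \<le> measure_pmf.expectation (T \<omega> t) (\<lambda>h. 64 / 3 * \<Omega>\<^sup>2 * 1)"
        unfolding T_def I_def by (intro integral_mono int mult_left_mono sum_grid_indicator_le_1 J) auto
      finally show "(\<Sum>m\<in>J. ?E m t) \<le> 64 / 3 * \<Omega>\<^sup>2" by simp
    qed
    finally show ?thesis by (simp add: mult.commute)
  qed
  \<comment> \<open>The pointwise bound is affine in \<open>a\<close> and \<open>b\<close>, so it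
    integrates over the seed directly.\<close>
  have "real (card J) * (ln 2 * (1 - 2 * (1 / 3))) \<le> real (card J) * (ln 2 * (1 - 2 * (\<integral>\<omega>. a \<omega> \<partial>M)))"
    using a by (intro mult_left_mono) auto
  also have "\<dots> = (\<integral>\<omega>. card J * (ln 2 * (1 - 2 * a \<omega>)) \<partial>M)"
    using int_a by (simp add: prob_space)
  also have "\<dots> \<le> (\<integral>\<omega>. (\<Sum>m\<in>J. 3 / 2 * b m \<omega> - 1 / 2) + 64 / 3 * \<Omega>\<^sup>2 * B \<partial>M)"
    using int_a int_b pointwise by (intro integral_mono) auto
  also have "\<dots> = (\<Sum>m\<in>J. 3 / 2 * (\<integral>\<omega>. b m \<omega> \<partial>M) - 1 / 2) + 64 / 3 * \<Omega>\<^sup>2 * B"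
    using int_b by (simp add: prob_space)
  \<comment> \<open>An error of at most 1/3 gives at most
    \<open>3 / 2 * (1 / 3) - 1 / 2 = 0\<close>.\<close>
  also have "(\<Sum>m\<in>J. 3 / 2 * (\<integral>\<omega>. b m \<omega> \<partial>M) - 1 / 2) \<le> (\<Sum>m\<in>J. 0)"
    by (intro sum_mono) (drule b, linarith)
  finally show ?thesis by (simp add: J mult.commute)
qed

section \<open>Choice of the constants\<close>

theorem theorem11:
  "\<exists>c>0. \<forall>L>0. \<exists>\<Omega>0>0. \<forall>\<Omega>. 0 < \<Omega> \<and> \<Omega> \<le> \<Omega>0 \<longrightarrow>
     (\<forall>B M (query :: nat \<Rightarrow> seed \<times> 'k::finite history \<Rightarrow> 'k query) decide.
        adaptive_algorithm B M query decide \<and> distinguishes L (1/4) \<Omega> (1/3) B M query decide \<longrightarrow>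
        real B \<ge> c * L ^ CARD('k) * \<Omega> powr - (real CARD('k) + 2))"
proof (rule exI[of _ "1 / (128 * 32 ^ CARD('k))"], intro conjI allI impI)
  \<comment> \<open>In the constant, \<open>32 ^ CARD('k)\<close> comes from
    \<open>n \<ge> L / (32 * \<Omega>)\<close>, and 128 is 6 times 64/3, using
    \<open>ln 2 / 3 \<ge> 1 / 6\<close>.\<close>
  fix L :: real
  assume L: "0 < L"
  show "\<exists>\<Omega>0>0. \<forall>\<Omega>. 0 < \<Omega> \<and> \<Omega> \<le> \<Omega>0 \<longrightarrow>
     (\<forall>B M (query :: nat \<Rightarrow> seed \<times> 'k::finite history \<Rightarrow> 'k query) decide.
        adaptive_algorithm B M query decide \<and> distinguishes L (1/4) \<Omega> (1/3) B M query decide \<longrightarrow>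
        real B \<ge> 1 / (128 * 32 ^ CARD('k)) * L ^ CARD('k) * \<Omega> powr - (real CARD('k) + 2))"
  proof (rule exI[of _ "min (1 / 32) (L / 16)"], intro conjI allI impI)
    fix \<Omega> B M and query :: "nat \<Rightarrow> seed \<times> 'k history \<Rightarrow> 'k query" and decide
    \<comment> \<open>The bound 1/32 keeps response probabilities in [1/4, 3/4];
      \<open>L / 16\<close> makes the base slope \<open>8 * \<Omega>\<close> at most
      \<open>L / 2\<close>.\<close>
    assume \<Omega>: "0 < \<Omega> \<and> \<Omega> \<le> min (1 / 32) (L / 16)"
      and A: "adaptive_algorithm B M query decide \<and> distinguishes L (1/4) \<Omega> (1/3) B M query decide"
    define k where "k = CARD('k)"
    \<comment> \<open>The largest \<open>n\<close> with
      \<open>8 * \<Omega> / L * n \<le> 3 / 4\<close>.\<close>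
    define n where "n = nat \<lfloor>3 * L / (32 * \<Omega>)\<rfloor>"
    have n: "real n \<le> 3 * L / (32 * \<Omega>)" "3 * L / (32 * \<Omega>) - 1 \<le> real n"
      using L \<Omega> by (auto simp: n_def)
    \<comment> \<open>The 1 lost to rounding is at most two thirds of
      \<open>3 * L / (32 * \<Omega>)\<close>.\<close>
    have "1 \<le> L / (16 * \<Omega>)"
      using L \<Omega> by (auto simp: field_simps)
    with n(2) have "L / (32 * \<Omega>) \<le> real n"
      by (simp add: field_simps)
    then have "(L / (32 * \<Omega>)) ^ k \<le> real n ^ k"
      using L \<Omega> by (intro power_mono) auto
    have "8 * \<Omega> / L * real n \<le> 8 * \<Omega> / L * (3 * L / (32 * \<Omega>))"
      using n(1) L \<Omega> by (intro mult_left_mono) auto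
    also have "\<dots> = 3 / 4"
      using L \<Omega> by simp
    finally have "ln 2 / 3 * real n ^ k \<le> 64 / 3 * \<Omega>\<^sup>2 * real B"
      unfolding k_def using A \<Omega> by (intro rounds_lower_bound[of \<Omega> L]) auto
    moreover have "1 / 2 / 3 * (L / (32 * \<Omega>)) ^ k \<le> ln 2 / 3 * real n ^ k"
      using \<open>(L / (32 * \<Omega>)) ^ k \<le> real n ^ k\<close> ln2_ge_two_thirds L \<Omega>
      by (intro mult_mono) auto
    ultimately have "(L / (32 * \<Omega>)) ^ k \<le> 128 * \<Omega>\<^sup>2 * real B"
      by linarith
    then have "(L / (32 * \<Omega>)) ^ k / (128 * \<Omega>\<^sup>2) \<le> real B"
      using \<Omega> by (simp add: pos_divide_le_eq mult_ac)
    have "\<Omega> powr - (real k + 2) = 1 / \<Omega> powr real (k + 2)"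
      by (simp only: powr_minus_divide of_nat_add of_nat_numeral)
    also have "\<dots> = 1 / (\<Omega> ^ k * \<Omega>\<^sup>2)"
      using \<Omega> by (simp only: powr_realpow power_add)
    finally have powr: "\<Omega> powr - (real k + 2) = 1 / (\<Omega> ^ k * \<Omega>\<^sup>2)" .
    have "1 / (128 * 32 ^ k) * L ^ k * \<Omega> powr - (real k + 2) = (L / (32 * \<Omega>)) ^ k / (128 * \<Omega>\<^sup>2)"
      unfolding powr by (simp add: power_divide power_mult_distrib)
    also have "\<dots> \<le> real B" by fact
    finally show "1 / (128 * 32 ^ CARD('k)) * L ^ CARD('k) * \<Omega> powr - (real CARD('k) + 2) \<le> real B"
      unfolding k_def .
  qed (use L in auto)
qed auto

end
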